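(* Let $\mathbb{K}$ be a field of characteristic zero and let $p,q$ be integers with $\min(p,q)\ge 2$ and $\max(p,q)\ge 3$. Then $$\operatorname{Lie}(x^p-y,\;y^q)=\mathbb{K}[x,y].$$
   Context: The polynomial algebra $\mathbb{K}[x,y]$ is regarded as a Lie algebra over $\mathbb{K}$ with the standard Poisson bracket $\{f,h\}=\frac{\partial f}{\partial x}\frac{\partial h}{\partial y}-\frac{\partial f}{\partial y}\frac{\partial h}{\partial x}$. For $f,g\in\mathbb{K}[x,y]$, $\operatorname{Lie}(f,g)$ denotes the Lie subalgebra of $(\mathbb{K}[x,y],\{\cdot,\cdot\})$ generated by $f$ and $g$. *)

theory Defs
  imports Main "HOL-Computational_Algebra.Polynomial"
begin

(* K[x,y] is the type 'a poly poly, read as K[x][y]: the outer indeterminate is y,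
   the coefficients are polynomials in x. *)
type_synonym 'a poly2 = "'a poly poly"

definition var_x :: "'a::field_char_0 poly2" where
  "var_x = [:[:0, 1:]:]"

definition var_y :: "'a::field_char_0 poly2" where
  "var_y = [:0, 1:]"

definition scale2 :: "'a::field_char_0 \<Rightarrow> 'a poly2 \<Rightarrow> 'a poly2" where
  "scale2 c f = smult [:c:] f"

definition diff_x :: "'a::field_char_0 poly2 \<Rightarrow> 'a poly2" where
  "diff_x f = map_poly pderiv f"

definition diff_y :: "'a::field_char_0 poly2 \<Rightarrow> 'a poly2" where
  "diff_y f = pderiv f"

definition poisson :: "'a::field_char_0 poly2 \<Rightarrow> 'a poly2 \<Rightarrow> 'a poly2" where
  "poisson f h = diff_x f * diff_y h - diff_y f * diff_x h"

interpretation poly2: vector_space "scale2 :: 'a::field_char_0 \<Rightarrow> 'a poly2 \<Rightarrow> 'a poly2"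
  by unfold_locales
    (simp_all add: scale2_def smult_add_right mult.commute flip: smult_add_left one_pCons)

definition lie_subalgebra :: "'a::field_char_0 poly2 set \<Rightarrow> bool" where
  "lie_subalgebra L \<longleftrightarrow> poly2.subspace L \<and> (\<forall>f\<in>L. \<forall>h\<in>L. poisson f h \<in> L)"

definition Lie :: "'a::field_char_0 poly2 \<Rightarrow> 'a poly2 \<Rightarrow> 'a poly2 set" where
  "Lie f g = lie_subalgebra hull {f, g}"

lemma coeff_diff_x:
  "coeff (coeff (diff_x f) j) i = of_nat (Suc i) * coeff (coeff f j) (Suc i)"
  by (simp add: diff_x_def coeff_map_poly coeff_pderiv)

lemma coeff_diff_y:
  "coeff (coeff (diff_y f) j) i = of_nat (Suc j) * coeff (coeff f (Suc j)) i"
  by (simp add: diff_y_def coeff_pderiv of_nat_poly del: of_nat_Suc)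

lemma poisson_xy: "poisson var_x var_y = 1"
  by (simp add: poisson_def diff_x_def diff_y_def var_x_def var_y_def map_poly_pCons pderiv_pCons
      one_pCons)

(* Lie f g really is the least Lie subalgebra containing f and g. *)
lemma lie_subalgebra_Lie: "lie_subalgebra (Lie f g)"
  unfolding Lie_def
  by (rule hull_in) (fastforce simp: lie_subalgebra_def intro!: poly2.subspace_Inter)

lemma Lie_least: "lie_subalgebra L \<Longrightarrow> f \<in> L \<Longrightarrow> g \<in> L \<Longrightarrow> Lie f g \<subseteq> L"
  unfolding Lie_def by (rule hull_minimal) auto

end

theory Submission
  imports Defs
begin

text \<open>
  Put \<open>f = x ^ p - y\<close> and write \<open>L\<close> for the subalgebra. Read in the coordinates \<open>x\<close> and \<open>f\<close>, the
  derivation \<open>{f, _}\<close> is differentiation with respect to \<open>x\<close>. Since \<open>y ^ q = (x ^ p - f) ^ q\<close>,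
  applying it \<open>p * (q - 1)\<close> times to \<open>y ^ q\<close> leaves only a nonzero multiple of \<open>x ^ p\<close> and a multiple
  of \<open>f\<close>, so \<open>x ^ p\<close> lies in \<open>L\<close>. Differentiating with \<open>{f, _}\<close>, then with \<open>{x, _}\<close>, shows that
  \<open>L\<close> contains \<open>x ^ i\<close> for \<open>i \<le> p\<close> and \<open>y ^ j\<close> for \<open>j \<le> q\<close>, in particular \<open>x ^ 2\<close>, \<open>y ^ 2\<close> and one
  of the cubes \<open>x ^ 3\<close>, \<open>y ^ 3\<close>. Brackets with \<open>x ^ 2\<close> and \<open>y ^ 2\<close> move along the monomials of a
  fixed degree, \<open>{x ^ n, x ^ 2 * y} = n * x ^ (n + 1)\<close> raises the degree and \<open>{x, _}\<close> lowers it, so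
  all monomials lie in \<open>L\<close>.
\<close>

section \<open>Calculus of the Poisson bracket and its iterates\<close>

lemma diff_x_add: "diff_x (f + g) = diff_x f + diff_x g"
  by (intro poly_eqI) (simp add: coeff_diff_x algebra_simps)

lemma diff_x_minus: "diff_x (- f) = - diff_x f"
  by (intro poly_eqI) (simp add: coeff_diff_x algebra_simps)

lemma diff_x_pCons: "diff_x (pCons c f) = pCons (pderiv c) (diff_x f)"
  by (simp add: diff_x_def map_poly_pCons)

lemma diff_x_smult: "diff_x (smult c f) = smult (pderiv c) f + smult c (diff_x f)"
  by (rule poly_eqI) (simp add: diff_x_def coeff_map_poly pderiv_mult)

lemma diff_x_mult: "diff_x (f * g) = f * diff_x g + g * diff_x f"
proof (induction f)
  case 0
  show ?case by (simp add: diff_x_def)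
next
  case (pCons c f)
  then show ?case
    by (simp add: diff_x_add diff_x_smult diff_x_pCons algebra_simps)
qed

lemma diff_y_mult: "diff_y (f * g) = f * diff_y g + g * diff_y f"
  by (simp add: diff_y_def pderiv_mult algebra_simps)

lemma diff_x_var [simp]: "diff_x var_x = 1" "diff_x var_y = 0"
  by (simp_all add: diff_x_def var_x_def var_y_def map_poly_pCons pderiv_pCons one_pCons)

lemma diff_y_var [simp]: "diff_y var_x = 0" "diff_y var_y = 1"
  by (simp_all add: diff_y_def var_x_def var_y_def pderiv_pCons one_pCons)

lemma poisson_add_right: "poisson f (g + h) = poisson f g + poisson f h"
  by (simp add: poisson_def diff_x_add diff_y_def pderiv_add algebra_simps)

lemma poisson_0_right [simp]: "poisson f 0 = 0"
  by (simp add: poisson_def diff_x_def diff_y_def)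

lemma poisson_self [simp]: "poisson f f = 0"
  by (simp add: poisson_def mult.commute)

lemma poisson_swap: "poisson f g = - poisson g f"
  by (simp add: poisson_def algebra_simps)

lemma poisson_minus_right: "poisson f (- g) = - poisson f g"
  by (simp add: poisson_def diff_x_minus diff_y_def pderiv_minus)

lemma poisson_mult_right: "poisson f (g * h) = g * poisson f h + h * poisson f g"
  by (simp add: poisson_def diff_x_mult diff_y_mult algebra_simps)

lemma poisson_mult_left: "poisson (f * g) h = f * poisson g h + g * poisson f h"
  by (simp add: poisson_def diff_x_mult diff_y_mult algebra_simps)

lemma poisson_1_right [simp]: "poisson f 1 = 0"
  using poisson_mult_right[of f 1 1] by simp

lemma poisson_of_nat_right [simp]: "poisson f (of_nat n) = 0"
  by (induction n) (simp_all add: poisson_add_right)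

lemma poisson_sum_right: "poisson f (sum g A) = (\<Sum>i\<in>A. poisson f (g i))"
  by (induction A rule: infinite_finite_induct) (simp_all add: poisson_add_right)

lemma poisson_power_right: "poisson f (g ^ n) = of_nat n * g ^ (n - 1) * poisson f g"
proof (induction n)
  case (Suc n)
  have "g * (of_nat n * g ^ (n - 1)) = of_nat n * g ^ n"
    by (cases n) (simp_all add: mult.left_commute)
  with Suc show ?case
    by (simp add: poisson_mult_right distrib_right flip: mult.assoc)
qed simp

lemma poisson_power_left: "poisson (f ^ n) g = of_nat n * f ^ (n - 1) * poisson f g"
  using poisson_swap[of "f ^ n" g] poisson_swap[of f g] by (simp add: poisson_power_right)

lemma poisson_yx: "poisson var_y var_x = -1"
  using poisson_swap[of var_y var_x] by (simp add: poisson_xy)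

text \<open>Here \<open>poisson f\<close> acts as differentiation in \<open>g\<close> with
  \<open>h\<close> as a constant. For \<open>k > n\<close> the factor with \<open>i = n\<close>
  makes the product zero, so truncated subtraction in \<open>g ^ (n - k)\<close> is
  harmless.\<close>

lemma iterated_poisson_power_mult:
  assumes "poisson f g = 1" and "poisson f h = 0"
  shows "(poisson f ^^ k) (g ^ n * h) = of_nat (\<Prod>i<k. n - i) * g ^ (n - k) * h"
proof (induction k)
  case (Suc k)
  then show ?case
    by (simp add: poisson_mult_right poisson_power_right assms
        mult.assoc mult.commute mult.left_commute del: of_nat_prod)
qed simp

lemma iterated_poisson_sum:
  "(poisson f ^^ k) (sum g A) = (\<Sum>i\<in>A. (poisson f ^^ k) (g i))"
  by (induction k) (simp_all add: poisson_sum_right)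

text \<open>In the binomial expansion, differentiating \<open>p * m\<close> times in
  \<open>g\<close> kills the powers \<open>g ^ (p * k)\<close> with \<open>k < m\<close>. Only
  \<open>k = m\<close> and \<open>k = Suc m\<close> survive, giving multiples of \<open>f\<close>
  and \<open>g ^ p\<close>.\<close>

lemma iterated_poisson_diff_power:
  assumes "poisson f g = 1" and "p > 0"
  shows "\<exists>a b. a > 0 \<and>
    (poisson f ^^ (p * m)) ((g ^ p - f) ^ Suc m) = of_nat a * g ^ p - of_nat b * f"
proof -
  define c where "c k = (\<Prod>i<p * m. p * k - i)" for k
  have D: "(poisson f ^^ (p * m)) (of_nat (Suc m choose k) * (g ^ p) ^ k * (- f) ^ (Suc m - k))
      = of_nat (c k) * g ^ (p * k - p * m) * (of_nat (Suc m choose k) * (- f) ^ (Suc m - k))" for k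
  proof -
    have "poisson f (of_nat (Suc m choose k) * (- f) ^ (Suc m - k)) = 0"
      by (simp add: poisson_mult_right poisson_power_right poisson_minus_right del: of_nat_Suc)
    from iterated_poisson_power_mult[OF assms(1) this, of "p * m" "p * k"]
    show ?thesis
      by (simp only: c_def flip: power_mult) (simp only: mult.assoc mult.left_commute)
  qed
  \<comment> \<open>The factor with \<open>i = p * k\<close> vanishes.\<close>
  have c0: "c k = 0" if "k < m" for k
  proof -
    have "p * k < p * m" using that assms by simp
    then show ?thesis unfolding c_def by (intro prod_zero) auto
  qed
  have c1: "c (Suc m) > 0"
    unfolding c_def using assms by (intro prod_pos) (auto simp: trans_less_add2)
  have "(g ^ p - f) ^ Suc m
      = (\<Sum>k\<le>Suc m. of_nat (Suc m choose k) * (g ^ p) ^ k * (- f) ^ (Suc m - k))"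
    using binomial_ring[of "g ^ p" "- f" "Suc m"] by simp
  then have "(poisson f ^^ (p * m)) ((g ^ p - f) ^ Suc m)
      = (\<Sum>k\<le>Suc m. of_nat (c k) * g ^ (p * k - p * m)
          * (of_nat (Suc m choose k) * (- f) ^ (Suc m - k)))"
    by (simp only: iterated_poisson_sum D)
  also have "\<dots> = of_nat (c (Suc m)) * g ^ p - of_nat (c m * Suc m) * f"
    by (simp add: lessThan_Suc_atMost[symmetric] c0 algebra_simps)
  finally show ?thesis using c1 by blast
qed

section \<open>Lie subalgebras of the polynomial algebra\<close>

lemma lie_subalgebra_poisson: "lie_subalgebra L \<Longrightarrow> f \<in> L \<Longrightarrow> g \<in> L \<Longrightarrow> poisson f g \<in> L"
  by (simp add: lie_subalgebra_def)

lemma lie_subalgebra_subspace: "lie_subalgebra L \<Longrightarrow> poly2.subspace L"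
  by (simp add: lie_subalgebra_def)

lemma of_nat_mult_eq_scale2: "of_nat n * f = scale2 (of_nat n) f"
  by (simp add: scale2_def of_nat_poly)

text \<open>Characteristic zero makes \<open>of_nat n\<close> invertible, so the integer factors
  produced by brackets can be cancelled.\<close>

lemma subspace_of_nat_mult_iff:
  assumes "poly2.subspace L" and "n > 0"
  shows "of_nat n * f \<in> L \<longleftrightarrow> f \<in> L"
proof
  assume "of_nat n * f \<in> L"
  then have "scale2 (1 / of_nat n) (of_nat n * f) \<in> L"
    by (rule poly2.subspace_scale[OF assms(1)])
  then show "f \<in> L"
    using assms(2) by (simp add: of_nat_mult_eq_scale2)
qed (simp add: of_nat_mult_eq_scale2 poly2.subspace_scale assms(1))

lemma lie_subalgebra_lower_powers:
  assumes L: "lie_subalgebra L" and "f \<in> L" "poisson f g = 1" "g ^ n \<in> L" "i \<le> n"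
  shows "g ^ i \<in> L"
  using \<open>i \<le> n\<close> \<open>g ^ n \<in> L\<close>
proof (induction rule: inc_induct)
  case (step k)
  then have "poisson f (g ^ Suc k) \<in> L"
    using L \<open>f \<in> L\<close> by (simp add: lie_subalgebra_poisson del: power_Suc)
  then show ?case
    using subspace_of_nat_mult_iff[OF lie_subalgebra_subspace[OF L], of "Suc k"]
    by (simp add: poisson_power_right assms(3) del: power_Suc of_nat_Suc)
qed

lemma subspace_monomials_UNIV:
  assumes L: "poly2.subspace L" and mon: "\<And>a b. var_x ^ a * var_y ^ b \<in> L"
  shows "L = UNIV"
proof -
  \<comment> \<open>A coefficient \<open>c\<close> is itself a polynomial in \<open>x\<close>. Each
    factor \<open>x\<close> split off from it is absorbed into the exponent, so \<open>a\<close>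
    must stay arbitrary.\<close>
  have 1: "smult c (var_x ^ a * var_y ^ b) \<in> L" for c a b
  proof (induction c arbitrary: a)
    case 0
    show ?case by (simp add: poly2.subspace_0[OF L])
  next
    case (pCons k c)
    have "smult (pCons k c) m = scale2 k m + smult c (var_x * m)" for m :: "'a poly2"
    proof -
      have "pCons k c = [:k:] + c * [:0, 1:]" and "var_x * m = smult [:0, 1:] m"
        by (simp_all add: var_x_def)
      then show ?thesis
        by (simp only: scale2_def smult_add_left smult_smult)
    qed
    then show ?case
      using poly2.subspace_add[OF L poly2.subspace_scale[OF L mon] pCons.IH[of "Suc a"]]
      by (simp add: mult.assoc)
  qed
  have "f * var_y ^ b \<in> L" for f b
  proof (induction f arbitrary: b)
    case 0
    show ?case by (simp add: poly2.subspace_0[OF L])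
  next
    case (pCons c f)
    have "pCons c f * var_y ^ b = smult c (var_x ^ 0 * var_y ^ b) + f * var_y ^ Suc b"
      by (simp add: var_y_def)
    then show ?case
      using poly2.subspace_add[OF L 1 pCons.IH] by metis
  qed
  from this[of _ 0] show ?thesis by auto
qed

lemma lie_subalgebra_quadratics_cubic_UNIV:
  assumes L: "lie_subalgebra L" and x: "var_x \<in> L"
    and x2: "var_x ^ 2 \<in> L" and y2: "var_y ^ 2 \<in> L"
    and cubic: "var_x ^ 3 \<in> L \<or> var_y ^ 3 \<in> L"
  shows "L = UNIV"
proof -
  note S = lie_subalgebra_subspace[OF L]
  note bracket = lie_subalgebra_poisson[OF L]
  note calc = poisson_mult_left poisson_mult_right poisson_power_left poisson_power_right
    poisson_xy poisson_yx
  \<comment> \<open>Bracketing with \<open>var_y ^ 2\<close> trades one \<open>x\<close> for one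
    \<open>y\<close>; below, \<open>var_x ^ 2\<close> does the reverse.\<close>
  have up: "var_x ^ a * var_y ^ Suc b \<in> L" if "var_x ^ Suc a * var_y ^ b \<in> L" for a b
  proof -
    have "poisson (var_x ^ Suc a * var_y ^ b) (var_y ^ 2)
        = of_nat (2 * Suc a) * (var_x ^ a * var_y ^ Suc b :: 'a poly2)"
      by (simp add: calc algebra_simps del: power_Suc) (simp add: algebra_simps)
    with bracket[OF that y2] subspace_of_nat_mult_iff[OF S, of "2 * Suc a"]
    show ?thesis by simp
  qed
  have down: "var_x ^ Suc a * var_y ^ b \<in> L" if "var_x ^ a * var_y ^ Suc b \<in> L" for a b
  proof -
    have "poisson (var_x ^ 2) (var_x ^ a * var_y ^ Suc b)
        = of_nat (2 * Suc b) * (var_x ^ Suc a * var_y ^ b :: 'a poly2)"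
      by (simp add: calc algebra_simps del: power_Suc) (simp add: algebra_simps)
    with bracket[OF x2 that] subspace_of_nat_mult_iff[OF S, of "2 * Suc b"]
    show ?thesis by simp
  qed
  \<comment> \<open>If the given cube is \<open>var_y ^ 3\<close>, three trades turn it into
    \<open>var_x ^ 3\<close>.\<close>
  have x3: "var_x ^ 3 \<in> L"
    using cubic down[of 0 2] down[of 1 1] down[of 2 0]
    by (auto simp: numeral_eq_Suc)
  have x2y: "var_x ^ 2 * var_y \<in> L"
    using up[of 2 0] x3 by (simp add: numeral_eq_Suc)
  have xn: "var_x ^ (n + 3) \<in> L" for n
  proof (induction n)
    case (Suc n)
    have "poisson (var_x ^ (n + 3)) (var_x ^ 2 * var_y)
        = of_nat (n + 3) * (var_x ^ (Suc n + 3) :: 'a poly2)"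
      by (simp add: calc) (simp add: algebra_simps numeral_eq_Suc)
    with bracket[OF Suc x2y] subspace_of_nat_mult_iff[OF S, of "n + 3"]
    show ?case by simp
  qed (use x3 in simp)
  \<comment> \<open>Each such monomial is reached from the pure power of \<open>x\<close> of the
    same degree by \<open>b\<close> trades.\<close>
  have high: "var_x ^ a * var_y ^ b \<in> L" if "a + b \<ge> 3" for a b
    using that
  proof (induction b arbitrary: a)
    case 0
    then show ?case using xn[of "a - 3"] by simp
  next
    case (Suc b)
    then show ?case using up[of a b] Suc.IH[of "Suc a"] by simp
  qed
  have lower: "var_x ^ a * var_y ^ b \<in> L" if "var_x ^ a * var_y ^ Suc b \<in> L" for a b
  proof -
    have "poisson var_x (var_x ^ a * var_y ^ Suc b)
        = of_nat (Suc b) * (var_x ^ a * var_y ^ b :: 'a poly2)"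
      by (simp add: calc algebra_simps del: power_Suc)
    with bracket[OF x that] subspace_of_nat_mult_iff[OF S, of "Suc b"]
    show ?thesis by simp
  qed
  \<comment> \<open>Multiplying by \<open>var_y ^ 3\<close> forces degree at least 3, and three
    brackets with \<open>x\<close> undo it.\<close>
  have "var_x ^ a * var_y ^ b \<in> L" for a b
    using high[of a "b + 3"] lower[of a b] lower[of a "Suc b"] lower[of a "Suc (Suc b)"]
    by (simp add: numeral_eq_Suc)
  then show ?thesis by (rule subspace_monomials_UNIV[OF S])
qed

theorem theorem10:
  fixes p q :: nat
  assumes "min p q \<ge> 2" and "max p q \<ge> 3"
  shows "Lie (var_x ^ p - var_y) (var_y ^ q) = (UNIV :: 'a::field_char_0 poly2 set)"
proof -
  define f :: "'a poly2" where "f = var_x ^ p - var_y"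
  define L where "L = Lie f (var_y ^ q)"
  have L: "lie_subalgebra L"
    unfolding L_def by (rule lie_subalgebra_Lie)
  note S = lie_subalgebra_subspace[OF L]
  have fL: "f \<in> L" and yqL: "var_y ^ q \<in> L"
    unfolding L_def Lie_def using hull_subset[of "{f, var_y ^ q}" lie_subalgebra] by auto
  have fx: "poisson f var_x = 1"
  proof -
    have "poisson var_x f = -1"
      using poisson_add_right[of var_x "var_x ^ p" "- var_y"]
      by (simp add: f_def poisson_power_right poisson_minus_right poisson_xy)
    then show ?thesis
      using poisson_swap[of f var_x] by simp
  qed
  obtain m where m: "q = Suc m"
    using assms by (cases q) auto
  obtain a b where a: "a > 0"
    and ab: "(poisson f ^^ (p * m)) ((var_x ^ p - f) ^ q) = of_nat a * var_x ^ p - of_nat b * f"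
    using iterated_poisson_diff_power[OF fx, of p m] assms m by auto
  have "(poisson f ^^ k) (var_y ^ q) \<in> L" for k
    by (induction k) (simp_all add: yqL fL lie_subalgebra_poisson[OF L])
  \<comment> \<open>Since \<open>var_x ^ p - f\<close> equals \<open>var_y\<close>, the expression
    in \<open>ab\<close> is an iterated bracket of \<open>var_y ^ q\<close>.\<close>
  then have "of_nat a * var_x ^ p - of_nat b * f \<in> L"
    using ab by (metis f_def diff_diff_eq2 add_diff_cancel_left')
  moreover have "of_nat b * f \<in> L"
    by (simp add: of_nat_mult_eq_scale2 poly2.subspace_scale[OF S] fL)
  ultimately have "of_nat a * var_x ^ p \<in> L"
    using poly2.subspace_add[OF S] by (metis diff_add_cancel)
  then have xpL: "var_x ^ p \<in> L"
    using subspace_of_nat_mult_iff[OF S a] by blast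
  have xL: "var_x ^ i \<in> L" if "i \<le> p" for i
    using lie_subalgebra_lower_powers[OF L fL fx xpL that] .
  have x: "var_x \<in> L"
    using xL[of 1] assms by simp
  have yL: "var_y ^ j \<in> L" if "j \<le> q" for j
    using lie_subalgebra_lower_powers[OF L x poisson_xy yqL that] .
  \<comment> \<open>The minimum bound supplies both squares, the maximum bound one of the
    cubes.\<close>
  have "L = UNIV"
    using assms by (intro lie_subalgebra_quadratics_cubic_UNIV[OF L x] xL yL)
      (auto intro: xL yL simp: max_def split: if_splits)
  then show ?thesis by (simp add: L_def f_def)
qed

end
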